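(* Let $V$ be a finite set, let $(\Omega,\pi)$ be a probability space, and let $f\in L^2(\Omega^{V},\pi^{\otimes V})$ be any real-valued function with $\mathrm{Var}(f)>0$. Let $\mathcal U$ be a random subset of $V$, independent of the $\sigma$-algebra $\mathcal F_V$ generated by all the coordinates. Then $$\mathbb E[\mathrm{clue}(f\mid \mathcal U)]\leq \delta(\mathcal U),\qquad\text{where } \delta(\mathcal U):=\max_{j\in V}\mathbb P[j\in\mathcal U].$$
   Context: For a fixed $U\subseteq V$, $\mathcal F_U$ denotes the $\sigma$-algebra on $\Omega^V$ generated by the coordinates in $U$, and $$\mathrm{clue}(f\mid U):=\frac{\mathrm{Var}(\mathbb E[f\mid\mathcal F_U])}{\mathrm{Var}(f)}.$$ For random $\mathcal U$, $\mathrm{clue}(f\mid\mathcal U)$ is the random variable obtained by evaluating $U\mapsto\mathrm{clue}(f\mid U)$ at $\mathcal U$, so $\mathbb E[\mathrm{clue}(f\mid \mathcal U)]=\sum_{U\subseteq V}\mathbb P[\mathcal U=U]\,\mathrm{clue}(f\mid U)$. The number $\delta(\mathcal U)$ is called the revealment of $\mathcal U$. *)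

theory Defs
  imports "HOL-Probability.Probability"
begin

definition coord_algebra :: "'a measure \<Rightarrow> 'v set \<Rightarrow> 'v set \<Rightarrow> ('v \<Rightarrow> 'a) measure" where
  "coord_algebra M V U =
     sigma (space (Pi\<^sub>M V (\<lambda>_. M)))
       {(\<lambda>x. x j) -` A \<inter> space (Pi\<^sub>M V (\<lambda>_. M)) | j A. j \<in> U \<and> A \<in> sets M}"

text \<open>\<open>real_cond_exp\<close> is the constant 0 unless its second argument is a subalgebra of the first;
  the following fact rules this degenerate case out.\<close>

lemma subalgebra_coord_algebra:
  assumes "U \<subseteq> V"
  shows "subalgebra (Pi\<^sub>M V (\<lambda>_. M)) (coord_algebra M V U)"
proof -
  have "(\<lambda>x. x j) -` A \<inter> space (Pi\<^sub>M V (\<lambda>_. M)) \<in> sets (Pi\<^sub>M V (\<lambda>_. M))"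
    if "j \<in> U" "A \<in> sets M" for j A
    using that assms by (intro measurable_sets[OF measurable_component_singleton]) auto
  then have "{(\<lambda>x. x j) -` A \<inter> space (Pi\<^sub>M V (\<lambda>_. M)) | j A. j \<in> U \<and> A \<in> sets M}
      \<subseteq> sets (Pi\<^sub>M V (\<lambda>_. M))"
    by blast
  then show ?thesis
    unfolding subalgebra_def coord_algebra_def
    by (auto simp: space_measure_of_conv sets.sigma_sets_subset intro!: sets.sigma_sets_subset
        dest: sets.sets_into_space subsetD split: if_splits simp: sets_measure_of_conv)
qed

definition clue :: "'a measure \<Rightarrow> 'v set \<Rightarrow> (('v \<Rightarrow> 'a) \<Rightarrow> real) \<Rightarrow> 'v set \<Rightarrow> real" where
  "clue M V f U =
     prob_space.variance (Pi\<^sub>M V (\<lambda>_. M))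
       (real_cond_exp (Pi\<^sub>M V (\<lambda>_. M)) (coord_algebra M V U) f)
     / prob_space.variance (Pi\<^sub>M V (\<lambda>_. M)) f"

text \<open>\<open>V\<close> is nonempty whenever some \<open>f\<close> on \<open>\<Omega>\<^sup>V\<close> has positive variance, so the maximum
  is then a genuine one.\<close>

definition revealment :: "'w measure \<Rightarrow> 'v set \<Rightarrow> ('w \<Rightarrow> 'v set) \<Rightarrow> real" where
  "revealment P V U = Max ((\<lambda>j. measure P {\<omega> \<in> space P. j \<in> U \<omega>}) ` V)"

end

theory Submission imports Defs begin

text \<open>
  Write \<open>g(U) = Var(E[f | F\<^sub>U])\<close>. Because the coordinates are independent, \<open>g\<close> is supermodular:
  revealing a further coordinate \<open>j\<close> adds at least as much variance on top of a larger set \<open>W\<close> as on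
  top of a smaller set \<open>U\<close>, since the martingale increment over \<open>U\<close> is the conditional expectation
  of the one over \<open>W\<close>. A supermodular set function vanishing at the empty set is dominated by an
  additive one with the same total mass (the marginal vector of a convex cooperative game): the
  weight of a coordinate is its increment in a fixed ordering of \<open>V\<close>. For an additive function with
  nonnegative weights the expectation over the random set is at most the revealment times the total
  mass, which is at most \<open>Var(f)\<close>.
\<close>

section \<open>Conditional expectations of square-integrable functions\<close>

lemma integrable_mult_of_squares:
  fixes f g :: "'a \<Rightarrow> real"
  assumes [measurable]: "f \<in> borel_measurable M" "g \<in> borel_measurable M"
    and "integrable M (\<lambda>x. (f x)\<^sup>2)" "integrable M (\<lambda>x. (g x)\<^sup>2)"
  shows "integrable M (\<lambda>x. f x * g x)"
proof (rule Bochner_Integration.integrable_bound)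
  show "integrable M (\<lambda>x. (f x)\<^sup>2 + (g x)\<^sup>2)"
    using assms by auto
  have "\<bar>a * b\<bar> \<le> a\<^sup>2 + b\<^sup>2" for a b :: real
  proof -
    have "0 \<le> (\<bar>a\<bar> - \<bar>b\<bar>)\<^sup>2" by simp
    then have "2 * (\<bar>a\<bar> * \<bar>b\<bar>) \<le> a\<^sup>2 + b\<^sup>2"
      by (simp add: power2_diff)
    moreover have "0 \<le> \<bar>a\<bar> * \<bar>b\<bar>" by simp
    ultimately show ?thesis unfolding abs_mult by linarith
  qed
  then show "AE x in M. norm (f x * g x) \<le> norm ((f x)\<^sup>2 + (g x)\<^sup>2)"
    by auto
qed measurable

context prob_space
begin

lemma sigma_finite_subalgebraI: "subalgebra M F \<Longrightarrow> sigma_finite_subalgebra M F"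
  by (intro finite_measure_subalgebra_is_sigma_finite finite_measure_subalgebra.intro
      finite_measure_subalgebra_axioms.intro) unfold_locales

text \<open>Conditional Jensen inequality for the convex function \<open>power2\<close>:
  conditioning is a contraction of L^2.\<close>

lemma real_cond_exp_square:
  fixes f :: "'a \<Rightarrow> real"
  assumes F: "subalgebra M F" and [measurable]: "f \<in> borel_measurable M"
    and f2: "integrable M (\<lambda>x. (f x)\<^sup>2)"
  shows integrable_real_cond_exp_square: "integrable M (\<lambda>x. (real_cond_exp M F f x)\<^sup>2)"
    and expectation_real_cond_exp_square_le:
      "expectation (\<lambda>x. (real_cond_exp M F f x)\<^sup>2) \<le> expectation (\<lambda>x. (f x)\<^sup>2)"
proof -
  interpret sigma_finite_subalgebra M F by (rule sigma_finite_subalgebraI[OF F])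
  have f: "integrable M f"
    by (rule square_integrable_imp_integrable[OF _ f2]) simp
  show int: "integrable M (\<lambda>x. (real_cond_exp M F f x)\<^sup>2)"
    by (rule integrable_convex_cond_exp[where q = power2 and I = UNIV])
      (use f f2 convex_power2 in auto)
  have "AE x in M. (real_cond_exp M F f x)\<^sup>2 \<le> real_cond_exp M F (\<lambda>x. (f x)\<^sup>2) x"
    by (rule real_cond_exp_jensens_inequality(2)[where q = power2 and I = UNIV])
      (use f f2 convex_power2 in auto)
  then have "expectation (\<lambda>x. (real_cond_exp M F f x)\<^sup>2)
      \<le> expectation (real_cond_exp M F (\<lambda>x. (f x)\<^sup>2))"
    by (intro integral_mono_AE int real_cond_exp_int f2)
  then show "expectation (\<lambda>x. (real_cond_exp M F f x)\<^sup>2) \<le> expectation (\<lambda>x. (f x)\<^sup>2)"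
    using real_cond_exp_int(2)[OF f2] by simp
qed

lemma variance_real_cond_exp:
  fixes f :: "'a \<Rightarrow> real"
  assumes F: "subalgebra M F" and [measurable]: "f \<in> borel_measurable M"
    and f2: "integrable M (\<lambda>x. (f x)\<^sup>2)"
  shows "variance (real_cond_exp M F f)
    = expectation (\<lambda>x. (real_cond_exp M F f x)\<^sup>2) - (expectation f)\<^sup>2"
proof -
  interpret sigma_finite_subalgebra M F by (rule sigma_finite_subalgebraI[OF F])
  have f: "integrable M f"
    by (rule square_integrable_imp_integrable[OF _ f2]) simp
  show ?thesis
    using variance_eq[OF real_cond_exp_int(1)[OF f] integrable_real_cond_exp_square[OF F _ f2]]
      real_cond_exp_int(2)[OF f] by simp
qed

lemma variance_real_cond_exp_le:
  fixes f :: "'a \<Rightarrow> real"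
  assumes F: "subalgebra M F" and [measurable]: "f \<in> borel_measurable M"
    and f2: "integrable M (\<lambda>x. (f x)\<^sup>2)"
  shows "variance (real_cond_exp M F f) \<le> variance f"
proof -
  have "integrable M f"
    by (rule square_integrable_imp_integrable[OF _ f2]) simp
  then show ?thesis
    using variance_real_cond_exp[OF assms] expectation_real_cond_exp_square_le[OF assms]
      variance_eq[of f] f2 by simp
qed

text \<open>Pythagoras in L^2: \<open>real_cond_exp M F f\<close> is the orthogonal projection of
  \<open>real_cond_exp M K f\<close>, so the second moments subtract; both have the mean of
  \<open>f\<close>, which cancels from the variances.\<close>

lemma variance_real_cond_exp_diff:
  fixes f :: "'a \<Rightarrow> real"
  assumes K: "subalgebra M K" and FK: "subalgebra K F"
    and f_meas [measurable]: "f \<in> borel_measurable M" and f2: "integrable M (\<lambda>x. (f x)\<^sup>2)"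
  shows "expectation (\<lambda>x. (real_cond_exp M K f x - real_cond_exp M F f x)\<^sup>2)
    = variance (real_cond_exp M K f) - variance (real_cond_exp M F f)"
proof -
  have F: "subalgebra M F"
    using K FK by (auto simp: subalgebra_def)
  interpret sigma_finite_subalgebra M F by (rule sigma_finite_subalgebraI[OF F])
  let ?k = "real_cond_exp M K f" and ?h = "real_cond_exp M F f"
  have f: "integrable M f"
    by (rule square_integrable_imp_integrable[OF _ f2]) simp
  note k2 = integrable_real_cond_exp_square[OF K f_meas f2]
    and h2 = integrable_real_cond_exp_square[OF F f_meas f2]
  have hk: "integrable M (\<lambda>x. ?h x * ?k x)"
    by (rule integrable_mult_of_squares) (use k2 h2 in auto)
  \<comment> \<open>As \<open>?h\<close> is measurable for \<open>F\<close>, the other factor may be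
    conditioned on \<open>F\<close>; the tower property then turns it into
    \<open>?h\<close>.\<close>
  have "expectation (\<lambda>x. ?h x * ?k x) = expectation (\<lambda>x. ?h x * real_cond_exp M F ?k x)"
    by (rule real_cond_exp_intg(2)[symmetric]) (use hk in auto)
  also have "\<dots> = expectation (\<lambda>x. (?h x)\<^sup>2)"
    using real_cond_exp_nested_subalg[OF K FK f]
    by (intro integral_cong_AE) (auto simp: power2_eq_square)
  finally have cross: "expectation (\<lambda>x. ?h x * ?k x) = expectation (\<lambda>x. (?h x)\<^sup>2)" .
  have "expectation (\<lambda>x. (?k x - ?h x)\<^sup>2)
      = expectation (\<lambda>x. ((?k x)\<^sup>2 + (?h x)\<^sup>2) - 2 * (?h x * ?k x))"
    by (intro Bochner_Integration.integral_cong) (auto simp: power2_diff)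
  also have "\<dots> = expectation (\<lambda>x. (?k x)\<^sup>2) - expectation (\<lambda>x. (?h x)\<^sup>2)"
    using k2 h2 hk cross by simp
  finally show ?thesis
    by (simp add: variance_real_cond_exp[OF K f_meas f2] variance_real_cond_exp[OF F f_meas f2])
qed

section \<open>Conditional expectation and independence\<close>

text \<open>The product of \<open>indicator C\<close> and \<open>g\<close> is measurable for
  \<open>G\<close>, and \<open>indicator D\<close> is measurable for \<open>H\<close>, so the
  expectation of their product factors.\<close>

lemma set_integral_Int_indep:
  fixes g :: "'a \<Rightarrow> real"
  assumes G: "subalgebra M G" and H: "subalgebra M H"
    and indep: "indep_set (sets G) (sets H)"
    and g_int: "integrable M g" and g_meas: "g \<in> borel_measurable G"
    and C: "C \<in> sets G" and D: "D \<in> sets H"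
  shows "(\<integral>x\<in>C \<inter> D. g x \<partial>M) = (\<integral>x\<in>C. g x \<partial>M) * prob D"
proof -
  have C_M: "C \<in> sets M" and D_M: "D \<in> sets M"
    using G H C D by (auto simp: subalgebra_def)
  let ?Y = "\<lambda>x. indicator C x * g x" and ?Z = "indicator D :: 'a \<Rightarrow> real"
  have Y [measurable]: "?Y \<in> borel_measurable G"
    using C g_meas by measurable
  have Z [measurable]: "?Z \<in> borel_measurable H"
    using D by measurable
  have YM: "?Y \<in> borel_measurable M" and ZM: "?Z \<in> borel_measurable M"
    using measurable_from_subalg[OF G Y] measurable_from_subalg[OF H Z] by auto
  have sp: "space G = space M" "space H = space M"
    using G H by (auto simp: subalgebra_def)
  \<comment> \<open>\<open>indep_var\<close> concerns the sigma-algebras generated by the two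
    variables; these lie inside \<open>G\<close> and \<open>H\<close> and inherit their
    independence.\<close>
  have "sigma_sets (space M) {?Y -` A \<inter> space M |A. A \<in> sets borel} \<subseteq> sets G"
    unfolding sp(1)[symmetric] using measurable_sets[OF Y] by (intro sets.sigma_sets_subset) auto
  moreover have "sigma_sets (space M) {?Z -` A \<inter> space M |A. A \<in> sets borel} \<subseteq> sets H"
    unfolding sp(2)[symmetric] using measurable_sets[OF Z] by (intro sets.sigma_sets_subset) auto
  ultimately have "indep_var borel ?Y borel ?Z"
    unfolding indep_var_eq using YM ZM indep
    unfolding indep_sets2_eq by (meson order_trans subsetD)
  moreover have "integrable M ?Y"
    using integrable_mult_indicator[OF C_M g_int] by simp
  moreover have "integrable M ?Z"
    using D_M by (simp add: emeasure_eq_measure)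
  ultimately have "expectation (\<lambda>x. ?Y x * ?Z x) = expectation ?Y * expectation ?Z"
    by (rule indep_var_lebesgue_integral)
  moreover have "expectation ?Z = prob D"
    using D_M by simp
  moreover have "(\<integral>x\<in>C \<inter> D. g x \<partial>M) = expectation (\<lambda>x. ?Y x * ?Z x)"
    unfolding set_lebesgue_integral_def
    by (intro Bochner_Integration.integral_cong) (auto split: split_indicator)
  ultimately show ?thesis
    by (simp add: set_lebesgue_integral_def)
qed

text \<open>Information \<open>H\<close> independent of \<open>G\<close>, hence jointly of
  \<open>F\<close> and \<open>g\<close>, does not help to predict \<open>g\<close> once
  \<open>F\<close> is known. The sets \<open>C \<inter> D\<close> with \<open>C\<close> in
  \<open>F\<close> and \<open>D\<close> in \<open>H\<close> form a pi-system generating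
  \<open>K\<close>, and over them the integrals of \<open>g\<close> and of its conditional
  expectation both factor through \<open>prob D\<close>.\<close>

lemma real_cond_exp_indep_join:
  fixes g :: "'a \<Rightarrow> real"
  assumes G: "subalgebra M G" and FG: "subalgebra G F" and H: "subalgebra M H"
    and K: "subalgebra M K" and K_eq: "sets K = sigma_sets (space M) (sets F \<union> sets H)"
    and indep: "indep_set (sets G) (sets H)"
    and g_int: "integrable M g" and g_meas: "g \<in> borel_measurable G"
  shows "AE x in M. real_cond_exp M K g x = real_cond_exp M F g x"
proof -
  have F: "subalgebra M F"
    using G FG by (auto simp: subalgebra_def)
  interpret F: sigma_finite_subalgebra M F by (rule sigma_finite_subalgebraI[OF F])
  interpret K: sigma_finite_subalgebra M K by (rule sigma_finite_subalgebraI[OF K])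
  have sp: "space F = space M" "space H = space M" "space K = space M"
    using F H K by (auto simp: subalgebra_def)
  have sub: "sets F \<subseteq> sets G" "sets F \<subseteq> sets M" "sets H \<subseteq> sets M" "sets K \<subseteq> sets M"
    using FG F H K by (auto simp: subalgebra_def)
  let ?h = "real_cond_exp M F g"
  let ?E = "{C \<inter> D |C D. C \<in> sets F \<and> D \<in> sets H}"
  have h_int: "integrable M ?h"
    by (rule F.real_cond_exp_int(1)[OF g_int])
  have E_sub: "?E \<subseteq> Pow (space M)"
    using sub sets.sets_into_space[of _ M] by blast
  have E_stable: "Int_stable ?E"
  proof (rule Int_stableI)
    fix a b assume "a \<in> ?E" "b \<in> ?E"
    then obtain C D C' D' where "a = C \<inter> D" "b = C' \<inter> D'"
      "C \<in> sets F" "D \<in> sets H" "C' \<in> sets F" "D' \<in> sets H" by blast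
    then have "a \<inter> b = (C \<inter> C') \<inter> (D \<inter> D')" "C \<inter> C' \<in> sets F" "D \<inter> D' \<in> sets H"
      by auto
    then show "a \<inter> b \<in> ?E" by blast
  qed
  have FH_E: "sets F \<union> sets H \<subseteq> ?E"
  proof
    fix a assume "a \<in> sets F \<union> sets H"
    moreover have "a \<inter> space M = a" "space M \<inter> a = a"
      using \<open>a \<in> sets F \<union> sets H\<close> sub sets.sets_into_space[of a M] by auto
    moreover have "space M \<in> sets F" "space M \<in> sets H"
      using sets.top[of F] sets.top[of H] sp by auto
    ultimately show "a \<in> ?E" by blast
  qed
  have K_E: "sets K \<subseteq> sigma_sets (space M) ?E"
    unfolding K_eq by (rule sigma_sets_mono') (rule FH_E)
  have E_M: "sigma_sets (space M) ?E \<subseteq> sets M"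
    using sub by (intro sets.sigma_sets_subset) blast
  \<comment> \<open>Viewed as measurable for the larger \<open>G\<close>, \<open>?h\<close> is open
    to the same factorisation as \<open>g\<close>.\<close>
  have h_G: "?h \<in> borel_measurable G"
    by (rule measurable_from_subalg[OF FG]) simp
  have set_int: "set_integrable M A g" "set_integrable M A ?h" if "A \<in> sets M" for A
    unfolding set_integrable_def
    using integrable_mult_indicator[OF that g_int] integrable_mult_indicator[OF that h_int] by auto
  \<comment> \<open>Pi-lambda argument: agreement of the two integrals passes to complements because
    the total integrals agree, and to disjoint countable unions by countable additivity.\<close>
  have "(\<integral>x\<in>A. g x \<partial>M) = (\<integral>x\<in>A. ?h x \<partial>M)" if "A \<in> sets K" for A
    using E_stable E_sub K_E[THEN subsetD, OF that]
  proof (induction rule: sigma_sets_induct_disjoint)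
    case (basic A)
    then obtain C D where A: "A = C \<inter> D" and C: "C \<in> sets F" and D: "D \<in> sets H" by blast
    then have "C \<in> sets G" using sub by auto
    then show ?case
      unfolding A set_integral_Int_indep[OF G H indep g_int g_meas \<open>C \<in> sets G\<close> D]
        set_integral_Int_indep[OF G H indep h_int h_G \<open>C \<in> sets G\<close> D]
      using F.real_cond_exp_intA[OF g_int C] by simp
  next
    case empty
    then show ?case by (simp add: set_lebesgue_integral_def)
  next
    case (compl A)
    then have A: "A \<in> sets M" using E_M by auto
    have "(\<integral>x\<in>space M - A. u x \<partial>M) = expectation u - (\<integral>x\<in>A. u x \<partial>M)"
      if u: "integrable M u" for u :: "'a \<Rightarrow> real"
    proof -
      have "(\<integral>x\<in>space M - A. u x \<partial>M) = expectation (\<lambda>x. u x - indicator A x *\<^sub>R u x)"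
        unfolding set_lebesgue_integral_def
        by (intro Bochner_Integration.integral_cong) (auto split: split_indicator)
      then show ?thesis
        using u integrable_mult_indicator[OF A u] by (simp add: set_lebesgue_integral_def)
    qed
    then show ?case
      using compl.IH g_int h_int F.real_cond_exp_int(2)[OF g_int] by simp
  next
    case (union A)
    then have A: "A i \<in> sets M" for i using E_M by auto
    have disj: "A i \<inter> A j = {}" if "i \<noteq> j" for i j
      using union.hyps(1) that by (auto simp: disjoint_family_on_def)
    have "(\<Union>i. A i) \<in> sets M" using A by auto
    then show ?case
      using lebesgue_integral_countable_add[OF A disj set_int(1)]
        lebesgue_integral_countable_add[OF A disj set_int(2)] union.IH by simp
  qed
  moreover have "?h \<in> borel_measurable K"
  proof (rule measurable_from_subalg)
    show "subalgebra K F"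
      using sp K_eq by (auto simp: subalgebra_def)
  qed simp
  ultimately show ?thesis
    by (intro K.real_cond_exp_charact g_int h_int)
qed

text \<open>Here \<open>F\<close> and \<open>G\<close> stand for a smaller and a larger coordinate
  set, \<open>K\<close> and \<open>L\<close> for the same sets with one more coordinate, and
  \<open>H\<close> for that coordinate. Conditioning the increment \<open>?d\<close> from
  \<open>G\<close> to \<open>L\<close> on \<open>K\<close> gives the increment from \<open>F\<close>
  to \<open>K\<close>. Conditioning cannot raise the second moment, and by Pythagoras these second
  moments are differences of variances.\<close>

lemma variance_real_cond_exp_supermodular:
  fixes f :: "'a \<Rightarrow> real"
  assumes L: "subalgebra M L" and LG: "subalgebra L G" and GF: "subalgebra G F"
    and LK: "subalgebra L K" and H: "subalgebra M H"
    and K_eq: "sets K = sigma_sets (space M) (sets F \<union> sets H)"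
    and indep: "indep_set (sets G) (sets H)"
    and f_meas [measurable]: "f \<in> borel_measurable M" and f2: "integrable M (\<lambda>x. (f x)\<^sup>2)"
  shows "variance (real_cond_exp M K f) - variance (real_cond_exp M F f)
    \<le> variance (real_cond_exp M L f) - variance (real_cond_exp M G f)"
proof -
  have G: "subalgebra M G" and K: "subalgebra M K"
    using L LG LK by (auto simp: subalgebra_def)
  then have F: "subalgebra M F"
    using GF by (auto simp: subalgebra_def)
  have KF: "subalgebra K F"
    using F K K_eq by (auto simp: subalgebra_def)
  interpret F: sigma_finite_subalgebra M F by (rule sigma_finite_subalgebraI[OF F])
  interpret K: sigma_finite_subalgebra M K by (rule sigma_finite_subalgebraI[OF K])
  interpret G: sigma_finite_subalgebra M G by (rule sigma_finite_subalgebraI[OF G])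
  interpret L: sigma_finite_subalgebra M L by (rule sigma_finite_subalgebraI[OF L])
  have f: "integrable M f"
    by (rule square_integrable_imp_integrable[OF _ f2]) simp
  let ?d = "\<lambda>x. real_cond_exp M L f x - real_cond_exp M G f x"
  have "integrable M (\<lambda>x. real_cond_exp M L f x * real_cond_exp M G f x)"
    by (rule integrable_mult_of_squares)
      (auto intro: integrable_real_cond_exp_square L G f2)
  then have d2: "integrable M (\<lambda>x. (?d x)\<^sup>2)"
    using integrable_real_cond_exp_square[OF L f_meas f2]
      integrable_real_cond_exp_square[OF G f_meas f2]
    by (simp add: power2_diff mult.assoc)
  have "AE x in M. real_cond_exp M K ?d x
      = real_cond_exp M K (real_cond_exp M L f) x - real_cond_exp M K (real_cond_exp M G f) x"
    by (intro K.real_cond_exp_diff L.real_cond_exp_int G.real_cond_exp_int f)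
  moreover have "AE x in M. real_cond_exp M K (real_cond_exp M L f) x = real_cond_exp M K f x"
    by (rule K.real_cond_exp_nested_subalg[OF L LK f])
  \<comment> \<open>Independence enters here: the inner conditional expectation is measurable for
    \<open>G\<close>, so \<open>H\<close> adds nothing to \<open>F\<close> in predicting it.\<close>
  moreover have "AE x in M. real_cond_exp M K (real_cond_exp M G f) x
      = real_cond_exp M F (real_cond_exp M G f) x"
    by (rule real_cond_exp_indep_join[OF G GF H K K_eq indep G.real_cond_exp_int(1)[OF f]]) simp
  moreover have "AE x in M. real_cond_exp M F (real_cond_exp M G f) x = real_cond_exp M F f x"
    by (rule F.real_cond_exp_nested_subalg[OF G GF f])
  ultimately have "AE x in M. real_cond_exp M K ?d x
      = real_cond_exp M K f x - real_cond_exp M F f x"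
    by eventually_elim simp
  then have "expectation (\<lambda>x. (real_cond_exp M K f x - real_cond_exp M F f x)\<^sup>2)
      = expectation (\<lambda>x. (real_cond_exp M K ?d x)\<^sup>2)"
    by (intro integral_cong_AE) auto
  also have "\<dots> \<le> expectation (\<lambda>x. (?d x)\<^sup>2)"
    by (rule expectation_real_cond_exp_square_le[OF K _ d2]) simp
  finally show ?thesis
    by (simp add: variance_real_cond_exp_diff[OF K KF f_meas f2]
        variance_real_cond_exp_diff[OF L LG f_meas f2])
qed

end

section \<open>Additive majorants of supermodular set functions\<close>

text \<open>Elements are added one at a time. Monotonicity makes each new weight nonnegative, the
  weights telescope to \<open>g V\<close>, and supermodularity shows that an element contributes no
  more to a subset of its predecessors than to all of them.\<close>

lemma supermodular_dominated_by_additive: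
  fixes g :: "'v set \<Rightarrow> real"
  assumes "finite V" and empty: "g {} = 0"
    and mono: "\<And>W j. W \<subseteq> V \<Longrightarrow> j \<in> V \<Longrightarrow> g W \<le> g (insert j W)"
    and supermod: "\<And>U W j. U \<subseteq> W \<Longrightarrow> W \<subseteq> V \<Longrightarrow> j \<in> V - W \<Longrightarrow>
      g (insert j U) - g U \<le> g (insert j W) - g W"
  obtains m :: "'v \<Rightarrow> real" where "\<And>j. j \<in> V \<Longrightarrow> 0 \<le> m j" "sum m V = g V"
    "\<And>U. U \<subseteq> V \<Longrightarrow> g U \<le> sum m U"
proof -
  have "\<exists>m. (\<forall>j\<in>W. 0 \<le> m j) \<and> sum m W = g W \<and> (\<forall>U\<subseteq>W. g U \<le> sum m U)"
    if "finite W" "W \<subseteq> V" for W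
    using that
  proof (induction W rule: finite_induct)
    case empty
    then show ?case using assms(2) by auto
  next
    case (insert j W)
    then obtain m where m: "\<forall>i\<in>W. 0 \<le> m i" "sum m W = g W" "\<forall>U\<subseteq>W. g U \<le> sum m U"
      by auto
    define m' where "m' = m(j := g (insert j W) - g W)"
    have eq: "sum m' U = sum m U" if "U \<subseteq> W" for U
      using that insert.hyps by (intro sum.cong) (auto simp: m'_def)
    have "g U \<le> sum m' U" if U: "U \<subseteq> insert j W" for U
    proof (cases "j \<in> U")
      case False
      then show ?thesis using U m(3) eq by (metis subset_insert)
    next
      case True
      let ?U = "U - {j}"
      have "?U \<subseteq> W" "insert j ?U = U" "finite ?U"
        using U True insert.hyps(1) by (auto intro: finite_subset)
      \<comment> \<open>Supermodularity compares adding \<open>j\<close> to \<open>?U\<close> with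
        adding it to all of \<open>W\<close>.\<close>
      then have "g U \<le> g ?U + (g (insert j W) - g W)"
        using supermod[of ?U W j] insert.hyps insert.prems by auto
      also have "\<dots> \<le> sum m ?U + m' j"
        using m(3) \<open>?U \<subseteq> W\<close> by (simp add: m'_def)
      also have "\<dots> = sum m' (insert j ?U)"
        using eq[OF \<open>?U \<subseteq> W\<close>] \<open>finite ?U\<close> by (subst sum.insert) auto
      finally show ?thesis using \<open>insert j ?U = U\<close> by simp
    qed
    moreover have "sum m' (insert j W) = g (insert j W)"
      using insert.hyps eq[of W] m(2) by (simp add: m'_def)
    moreover have "\<forall>i\<in>insert j W. 0 \<le> m' i"
      using m(1) mono[of W j] insert.prems by (auto simp: m'_def)
    ultimately show ?case by blast
  qed
  from this[OF assms(1)] that show ?thesis by blast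
qed

section \<open>Sigma-algebras generated by coordinates\<close>

lemma space_coord_algebra [simp]: "space (coord_algebra M V U) = space (Pi\<^sub>M V (\<lambda>_. M))"
  by (simp add: coord_algebra_def space_measure_of_conv)

text \<open>Grouping the generators by coordinate gives the form produced by
  \<open>indep_sets_collect_sigma\<close>.\<close>

lemma sets_coord_algebra:
  "sets (coord_algebra M V U) = sigma_sets (space (Pi\<^sub>M V (\<lambda>_. M)))
    (\<Union>j\<in>U. {(\<lambda>x. x j) -` A \<inter> space (Pi\<^sub>M V (\<lambda>_. M)) | A. A \<in> sets M})"
  unfolding coord_algebra_def
  by (subst sets_measure_of) (auto intro!: arg_cong[where f = "sigma_sets _"])

lemma subalgebra_coord_algebra_mono:
  "U \<subseteq> W \<Longrightarrow> subalgebra (coord_algebra M V W) (coord_algebra M V U)"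
  unfolding subalgebra_def sets_coord_algebra by (auto intro!: sigma_sets_mono' simp del: UN_simps)

text \<open>Supplies the join hypothesis \<open>K_eq\<close> of
  \<open>variance_real_cond_exp_supermodular\<close>.\<close>

lemma sets_coord_algebra_insert:
  "sets (coord_algebra M V (insert j U)) = sigma_sets (space (Pi\<^sub>M V (\<lambda>_. M)))
    (sets (coord_algebra M V U) \<union> sets (coord_algebra M V {j}))"
proof
  show "sigma_sets (space (Pi\<^sub>M V (\<lambda>_. M)))
      (sets (coord_algebra M V U) \<union> sets (coord_algebra M V {j}))
      \<subseteq> sets (coord_algebra M V (insert j U))"
    using subalgebra_coord_algebra_mono[OF subset_insertI, of M V j U]
      subalgebra_coord_algebra_mono[of "{j}" "insert j U" M V]
      sets.sigma_sets_subset[of "sets (coord_algebra M V U) \<union> sets (coord_algebra M V {j})"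
        "coord_algebra M V (insert j U)"]
    by (simp add: subalgebra_def)
  show "sets (coord_algebra M V (insert j U)) \<subseteq> sigma_sets (space (Pi\<^sub>M V (\<lambda>_. M)))
      (sets (coord_algebra M V U) \<union> sets (coord_algebra M V {j}))"
    unfolding sets_coord_algebra[of M V "insert j U"]
    by (rule sigma_sets_mono') (auto simp: sets_coord_algebra)
qed

text \<open>Coordinates are independent under a product measure, and sigma-algebras generated by
  disjoint blocks of independent families are again independent.\<close>

lemma indep_set_coord_algebra:
  assumes "prob_space M" and "W \<subseteq> V" and "j \<in> V - W"
  shows "prob_space.indep_set (Pi\<^sub>M V (\<lambda>_. M))
    (sets (coord_algebra M V W)) (sets (coord_algebra M V {j}))"
proof -
  let ?P = "Pi\<^sub>M V (\<lambda>_. M)"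
  interpret P: prob_space ?P
    using assms(1) by (intro prob_space_PiM)
  \<comment> \<open>The joint law of the coordinates is \<open>?P\<close>, which is also the product
    of their marginal laws; this equality characterises independence.\<close>
  have "distr ?P ?P (\<lambda>x. \<lambda>i\<in>V. x i) = ?P"
    by (rule distr_PiM_reindex[where f = "\<lambda>i. i"]) (use assms(1) in auto)
  moreover have "?P = (\<Pi>\<^sub>M i\<in>V. distr ?P M (\<lambda>x. x i))"
    by (intro PiM_cong refl distr_PiM_component[symmetric] assms(1))
  ultimately have "P.indep_vars (\<lambda>_. M) (\<lambda>i x. x i) V"
    using assms(3) by (subst P.indep_vars_iff_distr_eq_PiM') auto
  then have ind: "P.indep_sets (\<lambda>i. {(\<lambda>x. x i) -` A \<inter> space ?P | A. A \<in> sets M}) V"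
    by (simp add: P.indep_vars_def2)
  \<comment> \<open>The blocks \<open>W\<close> and \<open>{j}\<close> are indexed by the Booleans,
    as in the definition of \<open>indep_set\<close>.\<close>
  have "P.indep_sets (\<lambda>b. sigma_sets (space ?P)
      (\<Union>i\<in>case_bool W {j} b. {(\<lambda>x. x i) -` A \<inter> space ?P | A. A \<in> sets M})) UNIV"
  proof (rule P.indep_sets_collect_sigma)
    show "P.indep_sets (\<lambda>i. {(\<lambda>x. x i) -` A \<inter> space ?P | A. A \<in> sets M})
        (\<Union>b\<in>UNIV. case_bool W {j} b)"
      by (rule P.indep_sets_mono_index[OF _ ind]) (use assms in \<open>auto split: bool.splits\<close>)
    show "disjoint_family_on (case_bool W {j}) UNIV"
      using assms(3) by (auto simp: disjoint_family_on_def split: bool.splits)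
    show "Int_stable {(\<lambda>x. x i) -` A \<inter> space ?P | A. A \<in> sets M}" for i
    proof (rule Int_stableI)
      fix a b
      assume "a \<in> {(\<lambda>x. x i) -` A \<inter> space ?P | A. A \<in> sets M}"
        "b \<in> {(\<lambda>x. x i) -` A \<inter> space ?P | A. A \<in> sets M}"
      then obtain A B where "a = (\<lambda>x. x i) -` A \<inter> space ?P" "b = (\<lambda>x. x i) -` B \<inter> space ?P"
        "A \<in> sets M" "B \<in> sets M" by blast
      then have "a \<inter> b = (\<lambda>x. x i) -` (A \<inter> B) \<inter> space ?P" "A \<inter> B \<in> sets M" by auto
      then show "a \<inter> b \<in> {(\<lambda>x. x i) -` A \<inter> space ?P | A. A \<in> sets M}" by blast
    qed
  qed
  then show ?thesis
    unfolding P.indep_set_def sets_coord_algebra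
    by (rule back_subst[where P = "\<lambda>S. P.indep_sets S UNIV"]) (auto split: bool.splits)
qed

text \<open>With no coordinates the sigma-algebra is trivial, so the conditional expectation is
  almost everywhere the constant mean.\<close>

lemma variance_real_cond_exp_coord_algebra_empty:
  fixes f :: "('v \<Rightarrow> 'a) \<Rightarrow> real"
  assumes "prob_space M" and f: "integrable (Pi\<^sub>M V (\<lambda>_. M)) f"
  shows "prob_space.variance (Pi\<^sub>M V (\<lambda>_. M))
    (real_cond_exp (Pi\<^sub>M V (\<lambda>_. M)) (coord_algebra M V {}) f) = 0"
proof -
  let ?P = "Pi\<^sub>M V (\<lambda>_. M)" and ?F = "coord_algebra M V {}"
  interpret P: prob_space ?P
    using assms(1) by (intro prob_space_PiM)
  interpret F: sigma_finite_subalgebra ?P ?F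
    by (rule P.sigma_finite_subalgebraI[OF subalgebra_coord_algebra]) simp
  have "sets ?F = {{}, space ?P}"
    by (auto simp: sets_coord_algebra sigma_sets_empty_eq)
  then have "AE x in ?P. real_cond_exp ?P ?F f x = P.expectation f"
    by (intro F.real_cond_exp_charact)
      (auto simp: f set_integral_space P.prob_space, simp add: set_lebesgue_integral_def)
  then have "P.variance (real_cond_exp ?P ?F f) = P.expectation (\<lambda>x. 0)"
    using F.real_cond_exp_int(2)[OF f] by (intro integral_cong_AE) auto
  then show ?thesis by simp
qed

section \<open>Averaging the additive majorant over the random set\<close>

theorem theorem1p2:
  fixes V :: "'v set"
    and M :: "'a measure"
    and f :: "('v \<Rightarrow> 'a) \<Rightarrow> real"
    and P :: "'w measure"
    and X :: "'w \<Rightarrow> 'v \<Rightarrow> 'a"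
    and U :: "'w \<Rightarrow> 'v set"
  assumes "finite V"
    and "prob_space M"
    and "f \<in> borel_measurable (Pi\<^sub>M V (\<lambda>_. M))"
    and "integrable (Pi\<^sub>M V (\<lambda>_. M)) (\<lambda>x. (f x)\<^sup>2)"
    and "prob_space.variance (Pi\<^sub>M V (\<lambda>_. M)) f > 0"
    and "prob_space P"
    and "X \<in> measurable P (Pi\<^sub>M V (\<lambda>_. M))"
    and "distr P (Pi\<^sub>M V (\<lambda>_. M)) X = Pi\<^sub>M V (\<lambda>_. M)"
    and "U \<in> measurable P (count_space (Pow V))"
    and "prob_space.indep_set P
           (sets (vimage_algebra (space P) X (coord_algebra M V V)))
           (sets (vimage_algebra (space P) U (count_space (Pow V))))"
  shows "prob_space.expectation P (\<lambda>\<omega>. clue M V f (U \<omega>)) \<le> revealment P V U"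
proof -
  let ?Q = "Pi\<^sub>M V (\<lambda>_. M)"
  interpret Q: prob_space ?Q
    using assms(2) by (intro prob_space_PiM)
  interpret P: prob_space P by fact
  note f_meas = assms(3) and f2 = assms(4)
  have f: "integrable ?Q f"
    by (rule Q.square_integrable_imp_integrable[OF f_meas f2])
  \<comment> \<open>The numerator of \<open>clue\<close>; the division by the variance of
    \<open>f\<close> is left to the end.\<close>
  define g where "g W = Q.variance (real_cond_exp ?Q (coord_algebra M V W) f)" for W
  have increment: "g (insert j S) - g S \<le> g (insert j W) - g W"
    if "S \<subseteq> W" "W \<subseteq> V" "j \<in> V - W" for S W j
    unfolding g_def
    by (rule Q.variance_real_cond_exp_supermodular[where H = "coord_algebra M V {j}"])
      (use that in \<open>auto intro!: subalgebra_coord_algebra subalgebra_coord_algebra_mono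
        sets_coord_algebra_insert indep_set_coord_algebra assms(2) f_meas f2\<close>)
  \<comment> \<open>By Pythagoras each increment is the expectation of a square.\<close>
  have mono: "g W \<le> g (insert j W)" if "W \<subseteq> V" "j \<in> V" for W j
  proof -
    have "subalgebra ?Q (coord_algebra M V (insert j W))"
      using that by (intro subalgebra_coord_algebra) auto
    from Q.variance_real_cond_exp_diff[OF this
        subalgebra_coord_algebra_mono[OF subset_insertI] f_meas f2]
    have "g (insert j W) - g W = Q.expectation (\<lambda>x.
        (real_cond_exp ?Q (coord_algebra M V (insert j W)) f x
          - real_cond_exp ?Q (coord_algebra M V W) f x)\<^sup>2)"
      by (simp add: g_def)
    also have "\<dots> \<ge> 0" by simp
    finally show ?thesis by simp
  qed
  have "g {} = 0"
    unfolding g_def by (rule variance_real_cond_exp_coord_algebra_empty[OF assms(2) f])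
  with assms(1) obtain m where m: "\<And>j. j \<in> V \<Longrightarrow> 0 \<le> m j" "sum m V = g V"
    "\<And>S. S \<subseteq> V \<Longrightarrow> g S \<le> sum m S"
  proof (rule supermodular_dominated_by_additive)
    fix m assume "\<And>j. j \<in> V \<Longrightarrow> 0 \<le> m j" "sum m V = g V" "\<And>S. S \<subseteq> V \<Longrightarrow> g S \<le> sum m S"
    then show thesis by (rule that)
  qed (use mono increment in auto)
  have gV: "g V \<le> Q.variance f"
    unfolding g_def
    by (rule Q.variance_real_cond_exp_le[OF subalgebra_coord_algebra f_meas f2]) simp
  \<comment> \<open>Over the empty index set the product space is a single point, so
    \<open>f\<close> would have variance zero.\<close>
  have "V \<noteq> {}"
  proof
    assume "V = {}"
    then have "Q.expectation f = f (\<lambda>_. undefined)"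
      "Q.variance f = (f (\<lambda>_. undefined) - Q.expectation f)\<^sup>2"
      by (simp_all add: PiM_empty lebesgue_integral_count_space_finite)
    then show False using assms(5) by simp
  qed
  have U_sub: "U \<omega> \<subseteq> V" if "\<omega> \<in> space P" for \<omega>
    using measurable_space[OF assms(9) that] by simp
  have event: "{\<omega> \<in> space P. j \<in> U \<omega>} \<in> P.events" for j
  proof -
    have "{\<omega> \<in> space P. j \<in> U \<omega>} = U -` {S \<in> Pow V. j \<in> S} \<inter> space P"
      using U_sub by auto
    then show ?thesis
      using measurable_sets[OF assms(9), of "{S \<in> Pow V. j \<in> S}"] by auto
  qed
  let ?p = "\<lambda>j. P.prob {\<omega> \<in> space P. j \<in> U \<omega>}"
  have p_le: "?p j \<le> revealment P V U" if "j \<in> V" for j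
    unfolding revealment_def using that assms(1) by (intro Max_ge) auto
  have "0 \<le> revealment P V U"
    using \<open>V \<noteq> {}\<close> p_le by (meson ex_in_conv measure_nonneg order_trans)
  have finP: "finite (Pow V)" using assms(1) by simp
  have [measurable]: "(\<lambda>\<omega>. g (U \<omega>)) \<in> borel_measurable P"
    by (rule measurable_compose[OF assms(9)]) simp
  have g_int: "integrable P (\<lambda>\<omega>. g (U \<omega>))"
  proof (rule P.integrable_const_bound)
    \<comment> \<open>Only the finitely many values of \<open>g\<close> on \<open>Pow V\<close>
      occur, so their largest absolute value is a bound.\<close>
    show "AE \<omega> in P. norm (g (U \<omega>)) \<le> Max ((\<lambda>S. \<bar>g S\<bar>) ` Pow V)"
      using finP U_sub by (intro AE_I2) (auto intro!: Max_ge)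
  qed simp
  have int_j: "integrable P (\<lambda>\<omega>. m j * indicator {\<omega> \<in> space P. j \<in> U \<omega>} \<omega>)" for j
    using event[of j] by (intro integrable_mult_right) (simp add: P.emeasure_eq_measure)
  \<comment> \<open>The additive majorant is linear in the events that \<open>j\<close> is revealed,
    so its expectation depends only on their probabilities \<open>?p j\<close>.\<close>
  have "P.expectation (\<lambda>\<omega>. g (U \<omega>))
      \<le> P.expectation (\<lambda>\<omega>. \<Sum>j\<in>V. m j * indicator {\<omega> \<in> space P. j \<in> U \<omega>} \<omega>)"
  proof (rule integral_mono[OF g_int])
    fix \<omega> assume \<omega>: "\<omega> \<in> space P"
    have "sum m (U \<omega>) = (\<Sum>j\<in>V. if j \<in> U \<omega> then m j else 0)"
      using assms(1) U_sub[OF \<omega>] by (simp add: sum.inter_restrict[symmetric] Int_absorb1)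
    also have "\<dots> = (\<Sum>j\<in>V. m j * indicator {\<omega> \<in> space P. j \<in> U \<omega>} \<omega>)"
      using \<omega> by (intro sum.cong) auto
    finally show "g (U \<omega>) \<le> (\<Sum>j\<in>V. m j * indicator {\<omega> \<in> space P. j \<in> U \<omega>} \<omega>)"
      using m(3)[OF U_sub[OF \<omega>]] by simp
  qed (use int_j in auto)
  also have "\<dots> = (\<Sum>j\<in>V. m j * ?p j)"
    using int_j event by (subst Bochner_Integration.integral_sum) auto
  \<comment> \<open>Nonnegative weights allow each \<open>?p j\<close> to be replaced by the
    maximum.\<close>
  also have "\<dots> \<le> (\<Sum>j\<in>V. m j * revealment P V U)"
    using m(1) p_le by (intro sum_mono mult_left_mono) auto
  also have "\<dots> = g V * revealment P V U"
    by (simp add: sum_distrib_right[symmetric] m(2))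
  also have "\<dots> \<le> Q.variance f * revealment P V U"
    using gV \<open>0 \<le> revealment P V U\<close> by (rule mult_right_mono)
  finally have "P.expectation (\<lambda>\<omega>. g (U \<omega>)) / Q.variance f \<le> revealment P V U"
    using assms(5) by (simp add: pos_divide_le_eq mult.commute)
  then show ?thesis
    by (simp add: clue_def g_def)
qed

end
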